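(* Let $\Phi:[0,1]\to\mathbb R$ be continuous on $[0,1]$ and differentiable on $(0,1)$ with $\Phi'$ increasing, continuous and strictly concave on $(0,1)$. Then for $n\ge1$, $a,\rho\in(0,1)$ with $2^na\in\mathbb Z$, $$\mathbf{MaxStab}_\Phi(a)\le\Lambda_\rho(a)=\widetilde\Gamma_\rho(a):=\sup_{0\le z_2\le1-a}(1-a-p)\Phi(0)+p\Phi(a+\rho z_1)+a\Phi(a+\rho z_2),$$ where $z_1=\frac{z_2(\rho(1-z_2)-a)}{1-a-\rho z_2}$ and $p=\frac{a(1-a-\rho z_2)^2}{a+\rho^2z_2-(a+\rho z_2)^2}$.
   Context: $\mathbf X$ uniform on $\{-1,1\}^n$; $\mathbf Y$ obtained by independently flipping each coordinate of $\mathbf X$ with probability $(1-\rho)/2$; $T_\rho f(\mathbf x)=\mathbb E[f(\mathbf Y)\mid\mathbf X=\mathbf x]$; $\mathbf{MaxStab}_\Phi(a)=\max\{\mathbb E[\Phi(T_\rho f(\mathbf X))]:f:\{-1,1\}^n\to\{0,1\},\mathbb Ef(\mathbf X)=a\}$. $\Lambda_\rho(a)$ is the common value for $m\ge3$ of $\max\sum_{(s,i)\in\mathcal S\times[m]}p_{s,i}\Phi(a+\rho z_{s,i})$ over $z_{s,i}\in\mathbb R$, $p_{s,i}>0$ subject to $0\le a+\rho z_{s,i}\le1$, $\sum_ip_{s,i}=P_S(s)$ for $s\in\mathcal S$, $\sum_{s,i}p_{s,i}z_{s,i}=0$, $\sum_{s,i}p_{s,i}(z_{s,i}^2-sz_{s,i})\le0$,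 where $\mathcal S=\{-a,1-a\}$, $P_S(-a)=1-a$, $P_S(1-a)=a$. *)

theory Defs
  imports "HOL-Analysis.Analysis"
begin

definition cube :: "nat \<Rightarrow> (nat \<Rightarrow> real) set" where
  "cube n = PiE {..<n} (\<lambda>_. {-1, 1})"

(* P(Y = y | X = x): each coordinate flipped independently w.p. (1-rho)/2 *)
definition noise_prob :: "nat \<Rightarrow> real \<Rightarrow> (nat \<Rightarrow> real) \<Rightarrow> (nat \<Rightarrow> real) \<Rightarrow> real" where
  "noise_prob n \<rho> x y = (\<Prod>i<n. if y i = x i then (1 + \<rho>) / 2 else (1 - \<rho>) / 2)"

definition T_op :: "nat \<Rightarrow> real \<Rightarrow> ((nat \<Rightarrow> real) \<Rightarrow> real) \<Rightarrow> (nat \<Rightarrow> real) \<Rightarrow> real" where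
  "T_op n \<rho> f x = (\<Sum>y\<in>cube n. noise_prob n \<rho> x y * f y)"

definition cube_expect :: "nat \<Rightarrow> ((nat \<Rightarrow> real) \<Rightarrow> real) \<Rightarrow> real" where
  "cube_expect n g = (\<Sum>x\<in>cube n. g x) / 2 ^ n"

definition bool_funs :: "nat \<Rightarrow> ((nat \<Rightarrow> real) \<Rightarrow> real) set" where
  "bool_funs n = PiE (cube n) (\<lambda>_. {0, 1})"

definition MaxStab :: "nat \<Rightarrow> real \<Rightarrow> (real \<Rightarrow> real) \<Rightarrow> real \<Rightarrow> real" where
  "MaxStab n \<rho> \<Phi> a =
     Max ((\<lambda>f. cube_expect n (\<lambda>x. \<Phi> (T_op n \<rho> f x))) ` {f \<in> bool_funs n. cube_expect n f = a})"

(* The support S = {-a, 1-a}: True encodes 1-a, False encodes -a *)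
definition S_val :: "real \<Rightarrow> bool \<Rightarrow> real" where
  "S_val a s = (if s then 1 - a else - a)"

definition S_prob :: "real \<Rightarrow> bool \<Rightarrow> real" where
  "S_prob a s = (if s then a else 1 - a)"

definition Lambda_feasible :: "real \<Rightarrow> real \<Rightarrow> nat \<Rightarrow> (bool \<Rightarrow> nat \<Rightarrow> real) \<Rightarrow> (bool \<Rightarrow> nat \<Rightarrow> real) \<Rightarrow> bool" where
  "Lambda_feasible \<rho> a m p z \<longleftrightarrow>
     (\<forall>s. \<forall>i<m. p s i > 0 \<and> 0 \<le> a + \<rho> * z s i \<and> a + \<rho> * z s i \<le> 1) \<and>
     (\<forall>s. (\<Sum>i<m. p s i) = S_prob a s) \<and>
     (\<Sum>s\<in>UNIV. \<Sum>i<m. p s i * z s i) = 0 \<and>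
     (\<Sum>s\<in>UNIV. \<Sum>i<m. p s i * ((z s i)\<^sup>2 - S_val a s * z s i)) \<le> 0"

definition Lambda_m :: "real \<Rightarrow> real \<Rightarrow> nat \<Rightarrow> (real \<Rightarrow> real) \<Rightarrow> real" where
  "Lambda_m \<rho> a m \<Phi> =
     (SUP pz \<in> {(p, z). Lambda_feasible \<rho> a m p z}.
        (\<Sum>s\<in>UNIV. \<Sum>i<m. fst pz s i * \<Phi> (a + \<rho> * snd pz s i)))"

definition Gamma_tilde :: "real \<Rightarrow> real \<Rightarrow> (real \<Rightarrow> real) \<Rightarrow> real" where
  "Gamma_tilde \<rho> a \<Phi> =
     (SUP z2 \<in> {0..1 - a}.
        (let z1 = z2 * (\<rho> * (1 - z2) - a) / (1 - a - \<rho> * z2);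
             p = a * (1 - a - \<rho> * z2)\<^sup>2 / (a + \<rho>\<^sup>2 * z2 - (a + \<rho> * z2)\<^sup>2)
         in (1 - a - p) * \<Phi> 0 + p * \<Phi> (a + \<rho> * z1) + a * \<Phi> (a + \<rho> * z2)))"

definition strictly_concave_on :: "real set \<Rightarrow> (real \<Rightarrow> real) \<Rightarrow> bool" where
  "strictly_concave_on A f \<longleftrightarrow>
     (\<forall>x\<in>A. \<forall>y\<in>A. \<forall>t. x \<noteq> y \<and> 0 < t \<and> t < 1 \<longrightarrow>
        f ((1 - t) * x + t * y) > (1 - t) * f x + t * f y)"

end

theory Submission
  imports Defs
begin

text \<open>
  In terms of \<open>U = a + \<rho> Z\<close> and a \<open>{0,1}\<close>-valued \<open>F\<close> of mean \<open>a\<close>, the constraints read \<open>E[U] = a\<close> and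
  \<open>E[U\<^sup>2] \<le> \<rho> E[F U] + (1 - \<rho>) a\<^sup>2\<close>; the noise operator satisfies them with \<open>U = T\<^sub>\<rho> F\<close>.
  Given such \<open>U\<close>, put \<open>u\<^sub>2 = E[U | F = 1]\<close> and let \<open>u\<^sub>1\<close>, \<open>p\<close> be the corresponding quantities of the
  formula for \<open>\<Gamma>\<close>. Since \<open>\<Phi>'\<close> is concave, \<open>\<Phi>\<close> lies below the parabola touching it at \<open>u\<^sub>1\<close> and meeting it
  at \<open>0\<close>, and, as \<open>u\<^sub>1 \<le> u\<^sub>2\<close>, also below the parabola touching it at \<open>u\<^sub>2\<close> with the same leading
  coefficient \<open>\<gamma> \<ge> 0\<close>. Integrating the first over \<open>F = 0\<close> and the second over \<open>F = 1\<close> gives a bound that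
  depends only on \<open>u\<^sub>2\<close> and \<open>\<gamma> E[U\<^sup>2]\<close>, and that is sharp for the law with atoms \<open>0, u\<^sub>1\<close> on \<open>F = 0\<close> and
  \<open>u\<^sub>2\<close> on \<open>F = 1\<close>.
\<close>

section \<open>The noise operator on the cube\<close>

text \<open>Points of the cube are extensional functions, so updating coordinate \<open>n\<close>
  lifts a point of \<open>cube n\<close> to \<open>cube (Suc n)\<close>; inductions on the dimension
  rest on this.\<close>

lemma sum_cube_Suc:
  "(\<Sum>x\<in>cube (Suc n). g x) = (\<Sum>x\<in>cube n. g (x(n := 1)) + g (x(n := -1)))"
  for g :: "(nat \<Rightarrow> real) \<Rightarrow> 'b::comm_monoid_add"
proof -
  have cube: "cube (Suc n) = (\<lambda>(y, x). x(n := y)) ` ({-1, 1} \<times> cube n)"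
    unfolding cube_def lessThan_Suc by (rule PiE_insert_eq)
  have inj: "inj_on (\<lambda>(y, x). x(n := y)) ({-1, 1} \<times> cube n)"
    unfolding cube_def by (rule inj_combinator) simp
  have "(\<Sum>x\<in>cube (Suc n). g x) = (\<Sum>(y, x)\<in>{-1, 1} \<times> cube n. g (x(n := y)))"
    unfolding cube by (subst sum.reindex[OF inj]) (simp add: case_prod_unfold)
  also have "\<dots> = (\<Sum>y\<in>{-1, 1}. \<Sum>x\<in>cube n. g (x(n := y)))"
    by (rule sum.cartesian_product[symmetric])
  also have "\<dots> = (\<Sum>x\<in>cube n. g (x(n := 1)) + g (x(n := -1)))"
    by (simp add: sum.distrib add.commute)
  finally show ?thesis .
qed

lemma finite_cube: "finite (cube n)"
  unfolding cube_def by (intro finite_PiE) auto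

lemma card_cube: "card (cube n) = 2 ^ n"
  unfolding cube_def by (simp add: card_PiE numeral_2_eq_2)

lemma cube_expect_Suc:
  "cube_expect (Suc n) g = cube_expect n (\<lambda>x. (g (x(n := 1)) + g (x(n := -1))) / 2)"
  unfolding cube_expect_def sum_cube_Suc by (simp add: sum_divide_distrib[symmetric])

lemma cube_expect_add:
  "cube_expect n (\<lambda>x. f x + g x) = cube_expect n f + cube_expect n g"
  unfolding cube_expect_def by (simp add: sum.distrib add_divide_distrib)

lemma cube_expect_cmult: "cube_expect n (\<lambda>x. c * f x) = c * cube_expect n f"
  unfolding cube_expect_def by (simp add: sum_distrib_left[symmetric])

lemma cube_expect_nonneg: "(\<And>x. x \<in> cube n \<Longrightarrow> 0 \<le> f x) \<Longrightarrow> 0 \<le> cube_expect n f"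
  unfolding cube_expect_def by (simp add: sum_nonneg)

lemma noise_prob_Suc:
  "noise_prob (Suc n) \<rho> (x(n := s)) (y(n := t)) =
     noise_prob n \<rho> x y * (if t = s then (1 + \<rho>) / 2 else (1 - \<rho>) / 2)"
  unfolding noise_prob_def by simp

lemma T_op_lincomb:
  "T_op n \<rho> (\<lambda>x. c * f x + d * g x) x = c * T_op n \<rho> f x + d * T_op n \<rho> g x"
  unfolding T_op_def by (simp add: sum_distrib_left sum.distrib[symmetric] algebra_simps)

text \<open>Noise in one coordinate fixes the even part \<open>e\<close> and multiplies the odd part
  \<open>d\<close> by \<rho>. The coefficients are spelled out to match
  \<open>T_op_lincomb\<close>.\<close>

lemma T_op_Suc:
  fixes f :: "(nat \<Rightarrow> real) \<Rightarrow> real" and n :: nat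
  defines "e \<equiv> \<lambda>x. (1/2) * f (x(n := 1)) + (1/2) * f (x(n := -1))"
    and "d \<equiv> \<lambda>x. (1/2) * f (x(n := 1)) + (-1/2) * f (x(n := -1))"
  shows "T_op (Suc n) \<rho> f (x(n := 1)) = T_op n \<rho> e x + \<rho> * T_op n \<rho> d x"
    and "T_op (Suc n) \<rho> f (x(n := -1)) = T_op n \<rho> e x - \<rho> * T_op n \<rho> d x"
proof -
  have "T_op (Suc n) \<rho> f (x(n := 1)) =
      (1 + \<rho>) / 2 * T_op n \<rho> (\<lambda>x. f (x(n := 1))) x + (1 - \<rho>) / 2 * T_op n \<rho> (\<lambda>x. f (x(n := -1))) x"
    unfolding T_op_def sum_cube_Suc noise_prob_Suc
    by (simp add: sum_distrib_left sum.distrib[symmetric] mult_ac)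
  then show "T_op (Suc n) \<rho> f (x(n := 1)) = T_op n \<rho> e x + \<rho> * T_op n \<rho> d x"
    unfolding e_def d_def T_op_lincomb by (simp add: field_simps)
  have "T_op (Suc n) \<rho> f (x(n := -1)) =
      (1 - \<rho>) / 2 * T_op n \<rho> (\<lambda>x. f (x(n := 1))) x + (1 + \<rho>) / 2 * T_op n \<rho> (\<lambda>x. f (x(n := -1))) x"
    unfolding T_op_def sum_cube_Suc noise_prob_Suc
    by (simp add: sum_distrib_left sum.distrib[symmetric] mult_ac)
  then show "T_op (Suc n) \<rho> f (x(n := -1)) = T_op n \<rho> e x - \<rho> * T_op n \<rho> d x"
    unfolding e_def d_def T_op_lincomb by (simp add: field_simps)
qed

text \<open>The uniform law is stationary under the noise: the two \<open>d\<close> terms of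
  \<open>T_op_Suc\<close> cancel in the average.\<close>

lemma cube_expect_T_op: "cube_expect n (T_op n \<rho> f) = cube_expect n f"
proof (induction n arbitrary: f)
  case 0
  show ?case by (simp add: cube_expect_def cube_def T_op_def noise_prob_def)
next
  case (Suc n)
  let ?e = "\<lambda>x. (1/2) * f (x(n := 1)) + (1/2) * f (x(n := -1))"
  have "cube_expect (Suc n) (T_op (Suc n) \<rho> f) = cube_expect n (T_op n \<rho> ?e)"
    unfolding cube_expect_Suc T_op_Suc by simp
  also have "\<dots> = cube_expect n ?e"
    by (rule Suc)
  also have "\<dots> = cube_expect (Suc n) f"
    unfolding cube_expect_Suc by (simp add: add_divide_distrib)
  finally show ?case .
qed

text \<open>
  Splitting \<^term>\<open>f\<close> into its even and odd part in the last coordinate decouples both quadratic forms,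
  so that no Fourier expansion is needed; the odd part is controlled by the first inequality.
\<close>

lemma T_op_quadratic_forms:
  assumes "0 \<le> \<rho>" "\<rho> \<le> 1"
  shows "cube_expect n (\<lambda>x. (T_op n \<rho> f x)\<^sup>2) \<le> cube_expect n (\<lambda>x. f x * T_op n \<rho> f x) \<and>
    cube_expect n (\<lambda>x. (T_op n \<rho> f x)\<^sup>2) \<le>
      \<rho> * cube_expect n (\<lambda>x. f x * T_op n \<rho> f x) + (1 - \<rho>) * (cube_expect n f)\<^sup>2"
proof (induction n arbitrary: f)
  case 0
  show ?case
    by (simp add: cube_expect_def cube_def T_op_def noise_prob_def power2_eq_square algebra_simps)
next
  case (Suc n)
  let ?e = "\<lambda>x. (1/2) * f (x(n := 1)) + (1/2) * f (x(n := -1))"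
  let ?d = "\<lambda>x. (1/2) * f (x(n := 1)) + (-1/2) * f (x(n := -1))"
  define ee where "ee = cube_expect n (\<lambda>x. ?e x * T_op n \<rho> ?e x)"
  define dd where "dd = cube_expect n (\<lambda>x. ?d x * T_op n \<rho> ?d x)"
  define te where "te = cube_expect n (\<lambda>x. (T_op n \<rho> ?e x)\<^sup>2)"
  define td where "td = cube_expect n (\<lambda>x. (T_op n \<rho> ?d x)\<^sup>2)"
  have "(\<lambda>x. (f (x(n := 1)) * T_op (Suc n) \<rho> f (x(n := 1))
            + f (x(n := -1)) * T_op (Suc n) \<rho> f (x(n := -1))) / 2)
      = (\<lambda>x. ?e x * T_op n \<rho> ?e x + \<rho> * (?d x * T_op n \<rho> ?d x))"
    by (rule ext, unfold T_op_Suc) (simp add: field_simps)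
  then have A: "cube_expect (Suc n) (\<lambda>x. f x * T_op (Suc n) \<rho> f x) = ee + \<rho> * dd"
    unfolding cube_expect_Suc ee_def dd_def by (simp only: cube_expect_add cube_expect_cmult)
  have "(\<lambda>x. ((T_op (Suc n) \<rho> f (x(n := 1)))\<^sup>2 + (T_op (Suc n) \<rho> f (x(n := -1)))\<^sup>2) / 2)
      = (\<lambda>x. (T_op n \<rho> ?e x)\<^sup>2 + \<rho>\<^sup>2 * (T_op n \<rho> ?d x)\<^sup>2)"
    by (rule ext, unfold T_op_Suc) (simp add: field_simps power2_eq_square)
  then have B: "cube_expect (Suc n) (\<lambda>x. (T_op (Suc n) \<rho> f x)\<^sup>2) = te + \<rho>\<^sup>2 * td"
    unfolding cube_expect_Suc te_def td_def by (simp only: cube_expect_add cube_expect_cmult)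
  have C: "cube_expect (Suc n) f = cube_expect n ?e"
    unfolding cube_expect_Suc by (simp add: add_divide_distrib)
  have d: "td \<le> dd" and e: "te \<le> ee" and e': "te \<le> \<rho> * ee + (1 - \<rho>) * (cube_expect n ?e)\<^sup>2"
    unfolding td_def dd_def te_def ee_def
    using Suc.IH[of ?d] Suc.IH[of ?e] by blast+
  have "0 \<le> td"
    unfolding td_def by (rule cube_expect_nonneg) simp
  \<comment> \<open>The odd part has no mean to contribute. It enters the second inequality with
    factor \<open>\<rho>\<^sup>2\<close> on both sides, so \<open>td \<le> dd\<close> is enough for
    it.\<close>
  have sq: "\<rho>\<^sup>2 * td \<le> \<rho>\<^sup>2 * dd"
    using d by (intro mult_left_mono) auto
  have "\<rho>\<^sup>2 * dd \<le> \<rho> * dd"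
    using assms d \<open>0 \<le> td\<close> by (intro mult_right_mono) (auto simp: power2_eq_square mult_left_le)
  then have "te + \<rho>\<^sup>2 * td \<le> ee + \<rho> * dd"
    using e sq by linarith
  moreover have "te + \<rho>\<^sup>2 * td \<le> \<rho> * (ee + \<rho> * dd) + (1 - \<rho>) * (cube_expect n ?e)\<^sup>2"
    using e' sq by (simp add: algebra_simps power2_eq_square)
  ultimately show ?case
    unfolding A B C ..
qed

lemma sum_noise_prob:
  assumes "x \<in> cube n"
  shows "(\<Sum>y\<in>cube n. noise_prob n \<rho> x y) = 1"
proof -
  have "(\<Sum>y\<in>cube n. noise_prob n \<rho> x y) =
      (\<Prod>i<n. \<Sum>t\<in>{-1, 1}. if t = x i then (1 + \<rho>) / 2 else (1 - \<rho>) / 2)"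
    unfolding cube_def noise_prob_def by (subst prod_sum_PiE) auto
  also have "\<dots> = (\<Prod>i<n. 1)"
  proof (rule prod.cong)
    fix i assume "i \<in> {..<n}"
    then have "x i \<in> {-1, 1}"
      using assms unfolding cube_def by (rule PiE_mem[rotated])
    then show "(\<Sum>t\<in>{-1, 1}. if t = x i then (1 + \<rho>) / 2 else (1 - \<rho>) / 2) = 1"
      by (auto simp: field_simps)
  qed simp
  finally show ?thesis by simp
qed

lemma T_op_unit_interval:
  assumes "0 \<le> \<rho>" "\<rho> \<le> 1" "x \<in> cube n" "\<And>y. y \<in> cube n \<Longrightarrow> f y \<in> {0..1}"
  shows "T_op n \<rho> f x \<in> {0..1}"
proof -
  have nonneg: "0 \<le> noise_prob n \<rho> x y" for y
    unfolding noise_prob_def using assms by (intro prod_nonneg) auto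
  have "T_op n \<rho> f x \<le> (\<Sum>y\<in>cube n. noise_prob n \<rho> x y)"
    unfolding T_op_def using assms nonneg by (intro sum_mono) (auto intro: mult_left_le)
  moreover have "0 \<le> T_op n \<rho> f x"
    unfolding T_op_def using assms nonneg by (intro sum_nonneg) auto
  ultimately show ?thesis
    using sum_noise_prob[OF assms(3)] by simp
qed

section \<open>Parabolas above a function with concave derivative\<close>

lemma strictly_concave_on_add_affine:
  assumes "strictly_concave_on A f"
  shows "strictly_concave_on A (\<lambda>x. f x + (b * x + c))"
  unfolding strictly_concave_on_def
proof (intro ballI allI impI)
  fix x y t :: real
  assume "x \<in> A" "y \<in> A" "x \<noteq> y \<and> 0 < t \<and> t < 1"
  then have "(1 - t) * f x + t * f y < f ((1 - t) * x + t * y)"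
    using assms unfolding strictly_concave_on_def by blast
  then show "(1 - t) * (f x + (b * x + c)) + t * (f y + (b * y + c))
      < f ((1 - t) * x + t * y) + (b * ((1 - t) * x + t * y) + c)"
    by (simp add: algebra_simps)
qed

text \<open>The chord inequality without denominators: if two of the three values vanish, the sign
  of the third can be read off.\<close>

lemma strictly_concave_onD_between:
  assumes "strictly_concave_on A f" "x \<in> A" "z \<in> A" "x < y" "y < z"
  shows "(z - y) * f x + (y - x) * f z < (z - x) * f y"
proof -
  define t where "t = (y - x) / (z - x)"
  have t: "0 < t" "t < 1"
    using assms unfolding t_def by (auto simp: field_simps)
  have zx: "z - x > 0" and t_mult: "(z - x) * t = y - x"
    using assms unfolding t_def by auto
  have y: "(1 - t) * x + t * z = y"
    using t_mult by (simp add: algebra_simps)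
  have "(1 - t) * f x + t * f z < f y"
    using assms t y unfolding strictly_concave_on_def by (metis less_trans less_irrefl)
  then have "(z - x) * ((1 - t) * f x + t * f z) < (z - x) * f y"
    using zx by simp
  also have "(z - x) * ((1 - t) * f x + t * f z)
      = ((z - x) - (z - x) * t) * f x + ((z - x) * t) * f z"
    by (simp add: algebra_simps)
  finally show ?thesis
    unfolding t_mult by simp
qed

lemma strictly_concave_two_zeros_sign:
  assumes conc: "strictly_concave_on A h" and "c \<in> A" "v \<in> A" "c < v" "h c = 0" "h v = 0" "x \<in> A"
  shows "x < c \<Longrightarrow> h x < 0" "c < x \<Longrightarrow> x < v \<Longrightarrow> 0 < h x" "v < x \<Longrightarrow> h x < 0"
proof -
  show "h x < 0" if "x < c"
    using strictly_concave_onD_between[OF conc, of x v c] assms that by (simp add: mult_less_0_iff)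
  show "0 < h x" if "c < x" "x < v"
    using strictly_concave_onD_between[OF conc, of c v x] assms that by (simp add: zero_less_mult_iff)
  show "h x < 0" if "v < x"
    using strictly_concave_onD_between[OF conc, of c x v] assms that by (simp add: mult_less_0_iff)
qed

text \<open>
  The second-order divided difference \<open>\<Phi>[0, v, v]\<close>: the parabola touching \<open>\<Phi>\<close> at \<open>v\<close> with this
  leading coefficient also agrees with \<open>\<Phi>\<close> at \<open>0\<close>.
\<close>

definition div_diff :: "(real \<Rightarrow> real) \<Rightarrow> real \<Rightarrow> real" where
  "div_diff \<Phi> v = (\<Phi> 0 - \<Phi> v + v * deriv \<Phi> v) / v\<^sup>2"

definition parabola :: "(real \<Rightarrow> real) \<Rightarrow> real \<Rightarrow> real \<Rightarrow> real \<Rightarrow> real" where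
  "parabola \<Phi> \<gamma> v u = \<Phi> v + deriv \<Phi> v * (u - v) + \<gamma> * (u - v)\<^sup>2"

lemma parabola_div_diff_0: "v \<noteq> 0 \<Longrightarrow> parabola \<Phi> (div_diff \<Phi> v) v 0 = \<Phi> 0"
  unfolding parabola_def div_diff_def by (simp add: field_simps)

locale convex_concave_deriv =
  fixes \<Phi> :: "real \<Rightarrow> real"
  assumes cont: "continuous_on {0..1} \<Phi>"
    and diff: "\<forall>x\<in>{0<..<1}. \<Phi> differentiable (at x)"
    and deriv_mono: "mono_on {0<..<1} (deriv \<Phi>)"
    and deriv_concave: "strictly_concave_on {0<..<1} (deriv \<Phi>)"
begin

lemma has_deriv: "0 < x \<Longrightarrow> x < 1 \<Longrightarrow> (\<Phi> has_real_derivative deriv \<Phi> x) (at x)"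
  using diff by (simp add: DERIV_deriv_iff_real_differentiable)

text \<open>The mean slope of \<Phi> on \<open>[0, v]\<close> is a value of the increasing
  derivative at an earlier point. The sign is what lets an upper bound on \<open>E[U^2]\<close> be
  used.\<close>

lemma div_diff_nonneg:
  assumes "0 < v" "v < 1"
  shows "0 \<le> div_diff \<Phi> v"
proof -
  have "\<exists>l z. 0 < z \<and> z < v \<and> (\<Phi> has_real_derivative l) (at z) \<and> \<Phi> v - \<Phi> 0 = (v - 0) * l"
    using assms diff by (intro MVT continuous_on_subset[OF cont]) auto
  then obtain l z where z: "0 < z" "z < v" "(\<Phi> has_real_derivative l) (at z)" "\<Phi> v - \<Phi> 0 = v * l"
    by auto
  have "l \<le> deriv \<Phi> v"
    using deriv_mono z assms DERIV_imp_deriv[OF z(3)] by (auto simp: mono_on_def)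
  then have "v * l \<le> v * deriv \<Phi> v"
    using assms by simp
  then show ?thesis
    unfolding div_diff_def using z(4) by simp
qed

text \<open>
  The derivative of the gap is strictly concave and vanishes at \<open>v\<close> and, by Rolle's theorem, at some
  point of \<open>(0, v)\<close>; this fixes its sign pattern and hence the sign of the gap.
\<close>

lemma le_parabola_div_diff:
  assumes "0 < v" "v < 1" "u \<in> {0..1}"
  shows "\<Phi> u \<le> parabola \<Phi> (div_diff \<Phi> v) v u"
proof -
  define \<gamma> where "\<gamma> = div_diff \<Phi> v"
  define g where "g u = \<Phi> u - parabola \<Phi> \<gamma> v u" for u
  \<comment> \<open>The derivative of \<open>g\<close>, arranged as \<open>deriv \<Phi>\<close> plus
    an affine map so that it inherits strict concavity.\<close>
  define h where "h u = deriv \<Phi> u + (- 2 * \<gamma> * u + (2 * \<gamma> * v - deriv \<Phi> v))" for u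
  have der: "(g has_real_derivative h x) (at x)" if "0 < x" "x < 1" for x
    unfolding g_def h_def parabola_def
    by (rule derivative_eq_intros refl has_deriv that | simp)+ (simp add: algebra_simps)
  have contg: "continuous_on {0..1} g"
    unfolding g_def parabola_def by (intro continuous_intros cont)
  have g0: "g 0 = 0"
    unfolding g_def \<gamma>_def using assms by (simp add: parabola_div_diff_0)
  have gv: "g v = 0"
    unfolding g_def parabola_def by simp
  have hv: "h v = 0"
    unfolding h_def by simp
  have conc: "strictly_concave_on {0<..<1} h"
    unfolding h_def using deriv_concave by (rule strictly_concave_on_add_affine)
  have "\<exists>z. 0 < z \<and> z < v \<and> (g has_real_derivative 0) (at z)"
    using Rolle[of 0 v g] assms g0 gv der continuous_on_subset[OF contg, of "{0..v}"]
    by (force simp: real_differentiable_def)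
  then obtain c where c: "0 < c" "c < v" "h c = 0"
    using der assms by (metis DERIV_unique less_trans)
  have mem: "c \<in> {0<..<1}" "v \<in> {0<..<1}"
    using c assms by auto
  note sign = strictly_concave_two_zeros_sign[OF conc mem c(2,3) hv, THEN less_imp_le]
  have decr: "g t \<le> g s" if "s \<le> t" "0 \<le> s" "t \<le> 1" "\<And>x. s < x \<Longrightarrow> x < t \<Longrightarrow> h x \<le> 0" for s t
  proof (rule DERIV_nonpos_imp_decreasing_open[OF that(1)])
    show "\<exists>y. (g has_real_derivative y) (at x) \<and> y \<le> 0" if "s < x" "x < t" for x
      using der[of x] \<open>0 \<le> s\<close> \<open>t \<le> 1\<close> that \<open>\<And>x. s < x \<Longrightarrow> x < t \<Longrightarrow> h x \<le> 0\<close>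
      by (intro exI[of _ "h x"]) auto
  qed (use that in \<open>auto intro: continuous_on_subset[OF contg]\<close>)
  have incr: "g s \<le> g t" if "s \<le> t" "0 \<le> s" "t \<le> 1" "\<And>x. s < x \<Longrightarrow> x < t \<Longrightarrow> 0 \<le> h x" for s t
  proof (rule DERIV_nonneg_imp_increasing_open[OF that(1)])
    show "\<exists>y. (g has_real_derivative y) (at x) \<and> 0 \<le> y" if "s < x" "x < t" for x
      using der[of x] \<open>0 \<le> s\<close> \<open>t \<le> 1\<close> that \<open>\<And>x. s < x \<Longrightarrow> x < t \<Longrightarrow> 0 \<le> h x\<close>
      by (intro exI[of _ "h x"]) auto
  qed (use that in \<open>auto intro: continuous_on_subset[OF contg]\<close>)
  \<comment> \<open>\<open>g\<close> decreases on \<open>[0, c]\<close>, increases on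
    \<open>[c, v]\<close> and decreases on \<open>[v, 1]\<close>; each range is compared with its
    endpoint \<open>0\<close> or \<open>v\<close>, where \<open>g\<close> vanishes.\<close>
  consider "u \<le> c" | "c < u" "u \<le> v" | "v < u"
    by linarith
  then have "g u \<le> 0"
  proof cases
    case 1
    then have "g u \<le> g 0"
      using assms c by (intro decr) (auto intro: sign)
    then show ?thesis using g0 by simp
  next
    case 2
    then have "g u \<le> g v"
      using assms c by (intro incr) (auto intro: sign)
    then show ?thesis using gv by simp
  next
    case 3
    then have "g u \<le> g v"
      using assms c by (intro decr) (auto intro: sign)
    then show ?thesis using gv by simp
  qed
  then show ?thesis
    unfolding g_def \<gamma>_def by simp
qed

text \<open>Both parabolas pass through \<open>\<Phi> 0\<close> at \<open>0\<close>; removing this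
  value and dividing by \<open>u\<close> leaves affine maps
  \<open>b x + div_diff \<Phi> x * u\<close>. Each parabola is exact at its own touching point and
  above \<Phi> at the other, so the affine maps cross and their slopes compare.\<close>

lemma div_diff_antimono:
  assumes "0 < v" "v \<le> w" "w < 1"
  shows "div_diff \<Phi> w \<le> div_diff \<Phi> v"
proof (cases "v = w")
  case False
  define b where "b v = deriv \<Phi> v - 2 * div_diff \<Phi> v * v" for v
  have par: "parabola \<Phi> (div_diff \<Phi> x) x u = \<Phi> 0 + u * (b x + div_diff \<Phi> x * u)" if "x \<noteq> 0" for x u
    unfolding b_def parabola_div_diff_0[OF that, of \<Phi>, symmetric]
    by (simp add: parabola_def power2_eq_square algebra_simps)
  have "v * (b v + div_diff \<Phi> v * v) = \<Phi> v - \<Phi> 0"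
    using par[of v v] assms by (simp add: parabola_def)
  also have "\<dots> \<le> v * (b w + div_diff \<Phi> w * v)"
    using le_parabola_div_diff[of w v] par[of w v] assms by simp
  finally have 1: "b v + div_diff \<Phi> v * v \<le> b w + div_diff \<Phi> w * v"
    using assms by simp
  have "w * (b w + div_diff \<Phi> w * w) = \<Phi> w - \<Phi> 0"
    using par[of w w] assms by (simp add: parabola_def)
  also have "\<dots> \<le> w * (b v + div_diff \<Phi> v * w)"
    using le_parabola_div_diff[of v w] par[of v w] assms by simp
  finally have 2: "b w + div_diff \<Phi> w * w \<le> b v + div_diff \<Phi> v * w"
    using assms by simp
  have "div_diff \<Phi> w * (w - v) \<le> div_diff \<Phi> v * (w - v)"
    using 1 2 by (simp add: algebra_simps)
  then show ?thesis
    using assms False by simp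
qed simp

text \<open>A larger leading coefficient only lifts the parabola away from its touching point, so
  one coefficient can serve two touching points.\<close>

lemma le_parabola:
  assumes "0 < v" "v < 1" "div_diff \<Phi> v \<le> \<gamma>" "u \<in> {0..1}"
  shows "\<Phi> u \<le> parabola \<Phi> \<gamma> v u"
proof -
  have "div_diff \<Phi> v * (u - v)\<^sup>2 \<le> \<gamma> * (u - v)\<^sup>2"
    using assms(3) by (intro mult_right_mono) auto
  then show ?thesis
    using le_parabola_div_diff[of v u] assms unfolding parabola_def by simp
qed

lemma bounded_above: "\<exists>C. \<forall>u\<in>{0..1}. \<Phi> u \<le> C"
  using continuous_attains_sup[OF compact_Icc _ cont] by fastforce

end

section \<open>The three-atom profile\<close>

definition prof_z1 :: "real \<Rightarrow> real \<Rightarrow> real \<Rightarrow> real" where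
  "prof_z1 \<rho> a z = z * (\<rho> * (1 - z) - a) / (1 - a - \<rho> * z)"

definition prof_p :: "real \<Rightarrow> real \<Rightarrow> real \<Rightarrow> real" where
  "prof_p \<rho> a z = a * (1 - a - \<rho> * z)\<^sup>2 / (a + \<rho>\<^sup>2 * z - (a + \<rho> * z)\<^sup>2)"

definition prof_val :: "real \<Rightarrow> real \<Rightarrow> (real \<Rightarrow> real) \<Rightarrow> real \<Rightarrow> real" where
  "prof_val \<rho> a \<Phi> z =
     (1 - a - prof_p \<rho> a z) * \<Phi> 0 + prof_p \<rho> a z * \<Phi> (a + \<rho> * prof_z1 \<rho> a z) + a * \<Phi> (a + \<rho> * z)"

lemma Gamma_tilde_eq: "Gamma_tilde \<rho> a \<Phi> = (SUP z\<in>{0..1 - a}. prof_val \<rho> a \<Phi> z)"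
  unfolding Gamma_tilde_def prof_val_def prof_z1_def prof_p_def Let_def by simp

text \<open>With one atom at \<open>0\<close>, the mean equation and the second moment constraint
  taken with equality determine \<open>u\<^sub>1\<close> (by division) and then \<open>p\<close>;
  the last two facts are these equations.\<close>

lemma prof_properties:
  fixes a \<rho> z :: real
  assumes "0 < a" "a < 1" "0 < \<rho>" "\<rho> < 1" "0 \<le> z" "z \<le> 1 - a"
  defines "u\<^sub>1 \<equiv> a + \<rho> * prof_z1 \<rho> a z" and "u\<^sub>2 \<equiv> a + \<rho> * z" and "p \<equiv> prof_p \<rho> a z"
  shows "0 < u\<^sub>1" "u\<^sub>1 \<le> u\<^sub>2" "u\<^sub>2 < 1" "0 < p" "p \<le> 1 - a"
    "p * u\<^sub>1 = a * (1 - u\<^sub>2)" "p * u\<^sub>1\<^sup>2 + a * u\<^sub>2\<^sup>2 = \<rho> * (a * u\<^sub>2) + (1 - \<rho>) * a\<^sup>2"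
proof -
  define d where "d = \<rho> * z"
  \<comment> \<open>The denominator of \<open>prof_p\<close>; it equals
    \<open>u\<^sub>1 * (1 - u\<^sub>2)\<close>, and \<open>a * D\<close> is the second moment
    carried by \<open>F = 0\<close>.\<close>
  define D where "D = a + \<rho> * d - (a + d)\<^sup>2"
  have d: "0 \<le> d" "d \<le> \<rho> * (1 - a)"
    unfolding d_def using assms by simp_all
  have "\<rho> * (1 - a) < 1 * (1 - a)"
    using assms by (intro mult_strict_right_mono) auto
  then have d1: "d < 1 - a"
    using d by simp
  have u2: "u\<^sub>2 = a + d"
    unfolding u\<^sub>2_def d_def by simp
  show lt1: "u\<^sub>2 < 1"
    unfolding u2 using d1 by simp
  \<comment> \<open>The factorization shows that the atom at \<open>0\<close> loses its mass exactly
    at the two ends of the range of \<open>d\<close>.\<close>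
  have "(1 - a) * D - a * (1 - a - d)\<^sup>2 = d * (\<rho> * (1 - a) - d)"
    unfolding D_def by (simp add: power2_eq_square algebra_simps)
  moreover have "0 \<le> d * (\<rho> * (1 - a) - d)"
    using d by simp
  ultimately have D_ge: "a * (1 - a - d)\<^sup>2 \<le> (1 - a) * D"
    by linarith
  have num_pos: "0 < a * (1 - a - d)\<^sup>2"
    using assms d1 by simp
  then have D_pos: "0 < D"
    using D_ge assms by (metis diff_gt_0_iff_gt less_le_trans zero_less_mult_pos)
  have p: "p = a * (1 - a - d)\<^sup>2 / D"
    unfolding p_def prof_p_def D_def d_def by (simp add: power2_eq_square mult_ac)
  show "0 < p"
    unfolding p using num_pos D_pos by (rule divide_pos_pos)
  show "p \<le> 1 - a"
    unfolding p using D_pos D_ge by (simp add: pos_divide_le_eq)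
  have "u\<^sub>1 * (1 - a - d) = a * (1 - a - d) + d * (\<rho> - d - a)"
    unfolding u\<^sub>1_def prof_z1_def d_def using d1[unfolded d_def] by (simp add: field_simps)
  also have "\<dots> = D"
    unfolding D_def by (simp add: power2_eq_square algebra_simps)
  finally have u1_mult: "u\<^sub>1 * (1 - a - d) = D" .
  then have u1: "u\<^sub>1 = D / (1 - a - d)"
    using d1 by (simp add: field_simps)
  show "0 < u\<^sub>1"
    unfolding u1 using D_pos d1 by simp
  have "\<rho> * d \<le> d"
    using d assms by (simp add: mult_left_le_one_le)
  then have "D \<le> (a + d) * (1 - a - d)"
    unfolding D_def by (simp add: power2_eq_square algebra_simps)
  then show "u\<^sub>1 \<le> u\<^sub>2"
    unfolding u1 u2 using d1 by (simp add: pos_divide_le_eq)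
  show pu: "p * u\<^sub>1 = a * (1 - u\<^sub>2)"
  proof -
    define e where "e = 1 - a - d"
    have "e \<noteq> 0" "D \<noteq> 0" "1 - u\<^sub>2 = e"
      unfolding e_def u2 using d1 D_pos by simp_all
    then show ?thesis
      unfolding p u1 e_def[symmetric] by (simp add: power2_eq_square)
  qed
  have "p * u\<^sub>1\<^sup>2 = a * ((1 - u\<^sub>2) * u\<^sub>1)"
    using pu by (simp add: power2_eq_square flip: mult.assoc)
  also have "\<dots> = a * D"
    using u1_mult by (simp add: u2 mult.commute diff_diff_eq)
  finally show "p * u\<^sub>1\<^sup>2 + a * u\<^sub>2\<^sup>2 = \<rho> * (a * u\<^sub>2) + (1 - \<rho>) * a\<^sup>2"
    unfolding u2 D_def by (simp add: power2_eq_square algebra_simps)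
qed

section \<open>Moment bounds and comparison with the three-atom profile\<close>

lemma sum_parabola:
  fixes w U :: "'i \<Rightarrow> real"
  shows "(\<Sum>i\<in>I. w i * parabola \<Phi> \<gamma> v (U i)) =
    (\<Phi> v - deriv \<Phi> v * v + \<gamma> * v\<^sup>2) * (\<Sum>i\<in>I. w i)
      + (deriv \<Phi> v - 2 * \<gamma> * v) * (\<Sum>i\<in>I. w i * U i) + \<gamma> * (\<Sum>i\<in>I. w i * (U i)\<^sup>2)"
  unfolding parabola_def sum_distrib_left sum.distrib[symmetric]
  by (rule sum.cong) (simp_all add: power2_eq_square algebra_simps)

text \<open>A weighted variance about a free centre \<open>m\<close> is nonnegative; choosing
  \<open>m\<close> as the weighted mean gives the Jensen bound.\<close>

lemma weighted_sum_square_ge: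
  fixes w U :: "'i \<Rightarrow> real"
  assumes "\<And>i. i \<in> I \<Longrightarrow> 0 \<le> w i"
  shows "2 * m * (\<Sum>i\<in>I. w i * U i) - m\<^sup>2 * (\<Sum>i\<in>I. w i) \<le> (\<Sum>i\<in>I. w i * (U i)\<^sup>2)"
proof -
  have "0 \<le> (\<Sum>i\<in>I. w i * (U i - m)\<^sup>2)"
    using assms by (intro sum_nonneg) simp
  also have "\<dots> = (\<Sum>i\<in>I. w i * (U i)\<^sup>2) - 2 * m * (\<Sum>i\<in>I. w i * U i) + m\<^sup>2 * (\<Sum>i\<in>I. w i)"
    unfolding sum_distrib_left sum.distrib[symmetric] sum_subtractf[symmetric]
    by (rule sum.cong) (simp_all add: power2_eq_square algebra_simps)
  finally show ?thesis by simp
qed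

context convex_concave_deriv
begin

text \<open>Each profile value is a convex combination of values of \<Phi> on \<open>[0, 1]\<close>;
  boundedness is what makes the real supremum an upper bound.\<close>

lemma prof_val_bounded:
  assumes "0 < a" "a < 1" "0 < \<rho>" "\<rho> < 1"
  shows "bdd_above (prof_val \<rho> a \<Phi> ` {0..1 - a})"
proof -
  obtain C where C: "\<And>u. u \<in> {0..1} \<Longrightarrow> \<Phi> u \<le> C"
    using bounded_above by blast
  have "prof_val \<rho> a \<Phi> z \<le> C" if "z \<in> {0..1 - a}" for z
  proof -
    have z: "0 \<le> z" "z \<le> 1 - a"
      using that by auto
    note props = prof_properties[OF assms z]
    have "0 \<le> a + \<rho> * z" "a + \<rho> * prof_z1 \<rho> a z \<le> 1"
      using props(1-3) by linarith+
    then have "prof_val \<rho> a \<Phi> z \<le> (1 - a - prof_p \<rho> a z) * C + prof_p \<rho> a z * C + a * C"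
      unfolding prof_val_def using props(1) less_imp_le[OF props(3)] props(4,5) assms(1)
      by (intro add_mono mult_left_mono C) auto
    then show ?thesis
      by (simp add: algebra_simps)
  qed
  then show ?thesis
    by (rule bdd_aboveI2)
qed

text \<open>
  The index sets \<open>I\<close> and \<open>J\<close> carry the conditional laws of \<open>U = a + \<rho> Z\<close> given \<open>S = -a\<close> and
  \<open>S = 1 - a\<close>. The profile is the one with the same conditional means, so that parabolas with a common
  leading coefficient, touching \<open>\<Phi>\<close> on its support, compare the two values through \<open>E[U\<^sup>2]\<close> alone.
\<close>

lemma sum_le_Gamma_tilde:
  fixes w U :: "'i \<Rightarrow> real" and w' U' :: "'j \<Rightarrow> real"
  assumes a: "0 < a" "a < 1" and \<rho>: "0 < \<rho>" "\<rho> < 1"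
    and w: "\<And>i. i \<in> I \<Longrightarrow> 0 \<le> w i" and U: "\<And>i. i \<in> I \<Longrightarrow> U i \<in> {0..1}"
    and w': "\<And>j. j \<in> J \<Longrightarrow> 0 \<le> w' j" and U': "\<And>j. j \<in> J \<Longrightarrow> U' j \<in> {0..1}"
    and mass: "(\<Sum>i\<in>I. w i) = 1 - a" "(\<Sum>j\<in>J. w' j) = a"
    and mean: "(\<Sum>i\<in>I. w i * U i) + (\<Sum>j\<in>J. w' j * U' j) = a"
    and square: "(\<Sum>i\<in>I. w i * (U i)\<^sup>2) + (\<Sum>j\<in>J. w' j * (U' j)\<^sup>2)
      \<le> \<rho> * (\<Sum>j\<in>J. w' j * U' j) + (1 - \<rho>) * a\<^sup>2"
  shows "(\<Sum>i\<in>I. w i * \<Phi> (U i)) + (\<Sum>j\<in>J. w' j * \<Phi> (U' j)) \<le> Gamma_tilde \<rho> a \<Phi>"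
proof -
  define u\<^sub>2 where "u\<^sub>2 = (\<Sum>j\<in>J. w' j * U' j) / a"
  define d where "d = u\<^sub>2 - a"
  define z where "z = d / \<rho>"
  define u\<^sub>1 where "u\<^sub>1 = a + \<rho> * prof_z1 \<rho> a z"
  define p where "p = prof_p \<rho> a z"
  define \<gamma> where "\<gamma> = div_diff \<Phi> u\<^sub>1"
  have u2': "(\<Sum>j\<in>J. w' j * U' j) = a * u\<^sub>2"
    unfolding u\<^sub>2_def using a by simp
  then have "(\<Sum>i\<in>I. w i * U i) = a * (1 - u\<^sub>2)"
    using mean by (simp add: algebra_simps)
  note u2 = u2' this
  \<comment> \<open>Replacing both conditional second moments by squared conditional means
    (\<open>u\<^sub>2\<close> and \<open>m\<close>) in the constraint leaves
    \<open>d * d \<le> d * (\<rho> * (1 - a))\<close>, which puts \<open>z\<close> into the range of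
    the supremum.\<close>
  have "2 * u\<^sub>2 * (a * u\<^sub>2) - u\<^sub>2\<^sup>2 * a \<le> (\<Sum>j\<in>J. w' j * (U' j)\<^sup>2)"
    using weighted_sum_square_ge[of J w' u\<^sub>2 U'] w' by (simp add: u2 mass)
  moreover define m where "m = a * (1 - u\<^sub>2) / (1 - a)"
  have "2 * m * (a * (1 - u\<^sub>2)) - m\<^sup>2 * (1 - a) \<le> (\<Sum>i\<in>I. w i * (U i)\<^sup>2)"
    using weighted_sum_square_ge[of I w m U] w by (simp add: u2 mass)
  moreover have "m\<^sup>2 * (1 - a) = m * (a * (1 - u\<^sub>2))"
    unfolding m_def using a by (simp add: power2_eq_square)
  ultimately have "a * u\<^sub>2\<^sup>2 + m * (a * (1 - u\<^sub>2)) \<le> \<rho> * (a * u\<^sub>2) + (1 - \<rho>) * a\<^sup>2"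
    using square unfolding u2 by (simp add: power2_eq_square algebra_simps)
  then have "(1 - a) * (a * u\<^sub>2\<^sup>2 + m * (a * (1 - u\<^sub>2))) \<le> (1 - a) * (\<rho> * (a * u\<^sub>2) + (1 - \<rho>) * a\<^sup>2)"
    using a by (intro mult_left_mono) auto
  also have "(1 - a) * (a * u\<^sub>2\<^sup>2 + m * (a * (1 - u\<^sub>2))) = (1 - a) * a * u\<^sub>2\<^sup>2 + (a * (1 - u\<^sub>2))\<^sup>2"
    unfolding m_def using a by (simp add: field_simps power2_eq_square)
  finally have "a * (d * d) \<le> a * (d * (\<rho> * (1 - a)))"
    unfolding d_def by (simp add: power2_eq_square algebra_simps)
  then have dd: "d * d \<le> d * (\<rho> * (1 - a))"
    using a by simp
  have \<rho>a: "0 < \<rho> * (1 - a)"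
    using a \<rho> by simp
  have d0: "0 \<le> d"
  proof (rule ccontr)
    assume "\<not> 0 \<le> d"
    then have "d * (\<rho> * (1 - a)) < 0" "0 < d * d"
      using \<rho>a by (simp_all add: mult_less_0_iff zero_less_mult_iff)
    then show False using dd by simp
  qed
  moreover have "d \<le> \<rho> * (1 - a)"
    using dd d0 \<rho>a by (cases "d = 0") (auto simp: mult_le_cancel_left)
  ultimately have z: "0 \<le> z" "z \<le> 1 - a"
    unfolding z_def using \<rho> by (simp_all add: field_simps)
  have u2z: "u\<^sub>2 = a + \<rho> * z"
    unfolding z_def d_def using \<rho> by simp
  note props = prof_properties[OF a \<rho> z, folded u\<^sub>1_def p_def u2z]
  have \<gamma>: "0 \<le> \<gamma>" "div_diff \<Phi> u\<^sub>1 \<le> \<gamma>" "div_diff \<Phi> u\<^sub>2 \<le> \<gamma>"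
    unfolding \<gamma>_def using props(1-3) by (auto intro!: div_diff_nonneg div_diff_antimono)
  define sq where "sq = (\<Sum>i\<in>I. w i * (U i)\<^sup>2) + (\<Sum>j\<in>J. w' j * (U' j)\<^sup>2)"
  have "(\<Sum>i\<in>I. w i * \<Phi> (U i)) \<le> (\<Sum>i\<in>I. w i * parabola \<Phi> \<gamma> u\<^sub>1 (U i))"
    using w U props(1-3) \<gamma> by (intro sum_mono mult_left_mono le_parabola) auto
  moreover have "(\<Sum>j\<in>J. w' j * \<Phi> (U' j)) \<le> (\<Sum>j\<in>J. w' j * parabola \<Phi> \<gamma> u\<^sub>2 (U' j))"
    using w' U' props(1-3) \<gamma> by (intro sum_mono mult_left_mono le_parabola) auto
  moreover have "\<gamma> * sq \<le> \<gamma> * (p * u\<^sub>1\<^sup>2 + a * u\<^sub>2\<^sup>2)"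
    using square \<gamma> unfolding props(7) sq_def u2 by (intro mult_left_mono) auto
  \<comment> \<open>Masses and conditional means agree with those of the profile, so only the second
    moments can differ.\<close>
  moreover have "(\<Sum>i\<in>I. w i * parabola \<Phi> \<gamma> u\<^sub>1 (U i)) + (\<Sum>j\<in>J. w' j * parabola \<Phi> \<gamma> u\<^sub>2 (U' j)) =
      (1 - a - p) * parabola \<Phi> \<gamma> u\<^sub>1 0 + p * \<Phi> u\<^sub>1 + a * \<Phi> u\<^sub>2
        + \<gamma> * (sq - (p * u\<^sub>1\<^sup>2 + a * u\<^sub>2\<^sup>2))"
    unfolding sum_parabola mass u2 props(6)[symmetric] sq_def
    by (simp add: parabola_def power2_eq_square algebra_simps)
  moreover have "parabola \<Phi> \<gamma> u\<^sub>1 0 = \<Phi> 0"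
    unfolding \<gamma>_def using props(1) by (intro parabola_div_diff_0) simp
  ultimately have "(\<Sum>i\<in>I. w i * \<Phi> (U i)) + (\<Sum>j\<in>J. w' j * \<Phi> (U' j)) \<le> prof_val \<rho> a \<Phi> z"
    unfolding prof_val_def u\<^sub>1_def[symmetric] p_def[symmetric] u2z[symmetric]
    by (simp add: right_diff_distrib)
  also have "\<dots> \<le> Gamma_tilde \<rho> a \<Phi>"
    unfolding Gamma_tilde_eq using z a \<rho> by (intro cSUP_upper prof_val_bounded) auto
  finally show ?thesis .
qed

section \<open>Application to Boolean functions and to the constrained problem\<close>

lemma MaxStab_le_Gamma_tilde:
  assumes a: "0 < a" "a < 1" and \<rho>: "0 < \<rho>" "\<rho> < 1" and int: "2 ^ n * a \<in> \<int>"
  shows "MaxStab n \<rho> \<Phi> a \<le> Gamma_tilde \<rho> a \<Phi>"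
proof -
  let ?F = "{f \<in> bool_funs n. cube_expect n f = a}"
  have "finite (bool_funs n)"
    unfolding bool_funs_def by (intro finite_PiE finite_cube) simp
  then have fin: "finite ?F"
    by simp
  \<comment> \<open>\<open>Max\<close> needs a nonempty set: by integrality, the indicator of some
    \<open>2 ^ n * a\<close> points has mean \<open>a\<close>.\<close>
  have ne: "?F \<noteq> {}"
  proof -
    obtain k :: int where k: "2 ^ n * a = of_int k"
      using int by (auto elim: Ints_cases)
    have "0 \<le> (of_int k :: real)" "of_int k \<le> (2 ^ n :: real)"
      using a unfolding k[symmetric] by (auto simp: mult_left_le)
    then have nk: "real (nat k) = 2 ^ n * a" and "real (nat k) \<le> real (card (cube n))"
      using k unfolding card_cube by simp_all
    then have "nat k \<le> card (cube n)"
      by linarith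
    then obtain A where A: "A \<subseteq> cube n" "card A = nat k"
      by (meson obtain_subset_with_card_n)
    let ?f = "\<lambda>x\<in>cube n. if x \<in> A then 1 else 0 :: real"
    have "cube_expect n ?f = a"
      unfolding cube_expect_def using A nk finite_cube[of n]
      by (simp add: sum.If_cases Int_absorb1)
    moreover have "?f \<in> bool_funs n"
      unfolding bool_funs_def by auto
    ultimately show ?thesis by blast
  qed
  have "cube_expect n (\<lambda>x. \<Phi> (T_op n \<rho> f x)) \<le> Gamma_tilde \<rho> a \<Phi>" if "f \<in> ?F" for f
  proof -
    have fa: "cube_expect n f = a" and f01: "\<And>x. x \<in> cube n \<Longrightarrow> f x = 0 \<or> f x = 1"
      using that unfolding bool_funs_def by (auto dest: PiE_mem)
    define I where "I = {x \<in> cube n. f x = 0}"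
    define J where "J = {x \<in> cube n. f x = 1}"
    define w where "w = (1 / 2 ^ n :: real)"
    have split: "(\<Sum>x\<in>I. w * g x) + (\<Sum>x\<in>J. w * g x) = cube_expect n g" for g
    proof -
      have "cube n = I \<union> J" "I \<inter> J = {}" "finite I" "finite J"
        unfolding I_def J_def using f01 finite_cube[of n] by auto
      then show ?thesis
        unfolding cube_expect_def w_def
        by (simp add: sum.union_disjoint sum_divide_distrib add_divide_distrib)
    qed
    have splitJ: "(\<Sum>x\<in>J. w * g x) = cube_expect n (\<lambda>x. f x * g x)" for g
    proof -
      have "(\<Sum>x\<in>I. w * (f x * g x)) = 0" "(\<Sum>x\<in>J. w * (f x * g x)) = (\<Sum>x\<in>J. w * g x)"
        unfolding I_def J_def by (auto intro!: sum.neutral sum.cong)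
      then show ?thesis
        using split[of "\<lambda>x. f x * g x"] by simp
    qed
    have massJ: "(\<Sum>x\<in>J. w) = a"
      using splitJ[of "\<lambda>_. 1"] fa by simp
    moreover have "(\<Sum>x\<in>I. w) + (\<Sum>x\<in>J. w) = 1"
      using split[of "\<lambda>_. 1"] by (simp add: cube_expect_def card_cube)
    ultimately have massI: "(\<Sum>x\<in>I. w) = 1 - a"
      by simp
    have T01: "T_op n \<rho> f x \<in> {0..1}" if "x \<in> cube n" for x
      using that f01 \<rho> by (intro T_op_unit_interval) force+
    have "(\<Sum>x\<in>I. w * \<Phi> (T_op n \<rho> f x)) + (\<Sum>x\<in>J. w * \<Phi> (T_op n \<rho> f x)) \<le> Gamma_tilde \<rho> a \<Phi>"
    proof (rule sum_le_Gamma_tilde[OF a \<rho> _ _ _ _ massI massJ])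
      show "(\<Sum>x\<in>I. w * T_op n \<rho> f x) + (\<Sum>x\<in>J. w * T_op n \<rho> f x) = a"
        unfolding split cube_expect_T_op by (rule fa)
      show "(\<Sum>x\<in>I. w * (T_op n \<rho> f x)\<^sup>2) + (\<Sum>x\<in>J. w * (T_op n \<rho> f x)\<^sup>2)
          \<le> \<rho> * (\<Sum>x\<in>J. w * T_op n \<rho> f x) + (1 - \<rho>) * a\<^sup>2"
        \<comment> \<open>\<open>split\<close> must first fold the paired sums on the left, so that
          \<open>splitJ\<close> meets only the single sum on the right.\<close>
        unfolding split unfolding splitJ using T_op_quadratic_forms[of \<rho> n f] \<rho> fa by simp
    qed (use T01 in \<open>auto simp: w_def I_def J_def\<close>)
    then show ?thesis
      unfolding split .
  qed
  then show ?thesis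
    unfolding MaxStab_def using fin ne by (intro Max.boundedI) auto
qed

text \<open>Since \<open>S = F - a\<close> and \<open>E[Z] = 0\<close>, the quadratic constraint
  reads \<open>E[Z^2] \<le> E[F Z]\<close>; substituting \<open>U = a + \<rho> Z\<close> yields the
  moment constraints.\<close>

lemma Lambda_objective_le_Gamma_tilde:
  assumes a: "0 < a" "a < 1" and \<rho>: "0 < \<rho>" "\<rho> < 1" and feas: "Lambda_feasible \<rho> a m p z"
  shows "(\<Sum>s\<in>UNIV. \<Sum>i<m. p s i * \<Phi> (a + \<rho> * z s i)) \<le> Gamma_tilde \<rho> a \<Phi>"
proof -
  define M where "M s = (\<Sum>i<m. p s i * z s i)" for s
  define Q where "Q s = (\<Sum>i<m. p s i * (z s i)\<^sup>2)" for s
  have mass: "(\<Sum>i<m. p False i) = 1 - a" "(\<Sum>i<m. p True i) = a"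
    using feas unfolding Lambda_feasible_def S_prob_def by auto
  have mean: "M False + M True = 0"
    using feas unfolding Lambda_feasible_def M_def by (simp add: UNIV_bool)
  have "(\<Sum>i<m. p s i * ((z s i)\<^sup>2 - S_val a s * z s i)) = Q s - S_val a s * M s" for s
    unfolding Q_def M_def sum_distrib_left sum_subtractf[symmetric] by (simp add: algebra_simps)
  then have "Q False + Q True \<le> (1 - a) * M True - a * M False"
    using feas unfolding Lambda_feasible_def by (simp add: UNIV_bool S_val_def)
  also have "\<dots> = M True"
    using eq_neg_iff_add_eq_0[THEN iffD2, OF mean] by (simp add: algebra_simps)
  finally have QM: "Q False + Q True \<le> M True" .
  have lin: "(\<Sum>i<m. p s i * (a + \<rho> * z s i)) = a * (\<Sum>i<m. p s i) + \<rho> * M s" for s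
    unfolding M_def sum_distrib_left sum.distrib[symmetric] by (simp add: algebra_simps)
  have sq: "(\<Sum>i<m. p s i * (a + \<rho> * z s i)\<^sup>2)
      = a\<^sup>2 * (\<Sum>i<m. p s i) + 2 * a * \<rho> * M s + \<rho>\<^sup>2 * Q s" for s
    unfolding M_def Q_def sum_distrib_left sum.distrib[symmetric]
    by (simp add: algebra_simps power2_eq_square)
  have "(\<Sum>i<m. p False i * \<Phi> (a + \<rho> * z False i)) + (\<Sum>i<m. p True i * \<Phi> (a + \<rho> * z True i))
      \<le> Gamma_tilde \<rho> a \<Phi>"
  proof (rule sum_le_Gamma_tilde[OF a \<rho> _ _ _ _ mass])
    have "\<rho> * (M False + M True) = 0"
      using mean by simp
    then show "(\<Sum>i<m. p False i * (a + \<rho> * z False i)) + (\<Sum>i<m. p True i * (a + \<rho> * z True i)) = a"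
      unfolding lin mass by (simp add: algebra_simps)
    have "\<rho>\<^sup>2 * (Q False + Q True) \<le> \<rho>\<^sup>2 * M True"
      using QM by (intro mult_left_mono) auto
    moreover have "2 * a * \<rho> * (M False + M True) = 0"
      using mean by simp
    ultimately show "(\<Sum>i<m. p False i * (a + \<rho> * z False i)\<^sup>2) + (\<Sum>i<m. p True i * (a + \<rho> * z True i)\<^sup>2)
        \<le> \<rho> * (\<Sum>i<m. p True i * (a + \<rho> * z True i)) + (1 - \<rho>) * a\<^sup>2"
      unfolding lin sq mass by (simp add: algebra_simps power2_eq_square)
  qed (use feas in \<open>auto simp: Lambda_feasible_def less_imp_le\<close>)
  then show ?thesis
    by (simp add: UNIV_bool)
qed

end

text \<open>Atoms may repeat, so an atom's mass can be spread over several indices; each value of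
  \<open>s\<close> carries at most two distinct atoms.\<close>

lemma prof_val_attained:
  fixes a \<rho> z :: real and \<Phi> :: "real \<Rightarrow> real"
  assumes a: "0 < a" "a < 1" and \<rho>: "0 < \<rho>" "\<rho> < 1" and z: "0 \<le> z" "z \<le> 1 - a" and m: "2 \<le> m"
  shows "\<exists>q y. Lambda_feasible \<rho> a m q y \<and>
    (\<Sum>s\<in>UNIV. \<Sum>i<m. q s i * \<Phi> (a + \<rho> * y s i)) = prof_val \<rho> a \<Phi> z"
proof -
  define z\<^sub>1 where "z\<^sub>1 = prof_z1 \<rho> a z"
  define p where "p = prof_p \<rho> a z"
  note props = prof_properties[OF a \<rho> z, folded z\<^sub>1_def p_def]
  define r where "r = 1 - a - p"
  have r: "0 \<le> r" "p = 1 - a - r"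
    unfolding r_def using props by simp_all
  \<comment> \<open>Index \<open>0\<close> is kept for the atom \<open>u = 0\<close>, that is
    \<open>- a / \<rho>\<close> in terms of \<open>z\<close>; the other \<open>k\<close> indices
    share the mass \<open>p\<close>.\<close>
  obtain k where k: "m = Suc k" "0 < k"
    using m by (cases m) auto
  \<comment> \<open>All weights must be positive, so the atom at \<open>u = 0\<close> is omitted when its mass \<open>r\<close> vanishes.\<close>
  define y where "y s i = (if s then z else if i = 0 \<and> 0 < r then - a / \<rho> else z\<^sub>1)" for s and i :: nat
  define q where "q s i = (if s then a / m else if 0 < r then if i = 0 then r else p / k else p / m)"
    for s and i :: nat
  \<comment> \<open>A general test function \<open>g\<close> gives mass, mean, second moment and
    objective at once.\<close>
  have sums: "(\<Sum>i<m. q True i * g (y True i)) = a * g z"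
    "(\<Sum>i<m. q False i * g (y False i)) = r * g (- a / \<rho>) + p * g z\<^sub>1" for g :: "real \<Rightarrow> real"
  proof -
    show "(\<Sum>i<m. q True i * g (y True i)) = a * g z"
      unfolding q_def y_def using k by simp
    show "(\<Sum>i<m. q False i * g (y False i)) = r * g (- a / \<rho>) + p * g z\<^sub>1"
    proof (cases "0 < r")
      case True
      then show ?thesis
        unfolding q_def y_def k(1) sum.lessThan_Suc_shift using k by simp
    next
      case False
      then show ?thesis
        unfolding q_def y_def using k r by simp
    qed
  qed
  have mean: "p * (a + \<rho> * z\<^sub>1) + a * (a + \<rho> * z) = a"
    using props(6) by (simp add: algebra_simps)
  have r0: "\<rho> * (r * (- a / \<rho>)) = - a * r" "\<rho>\<^sup>2 * (r * (- a / \<rho>)\<^sup>2) = a\<^sup>2 * r"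
    using \<rho> by (simp_all add: power2_eq_square)
  have lin: "r * (- a / \<rho>) + p * z\<^sub>1 + a * z = 0"
  proof -
    have "\<rho> * (r * (- a / \<rho>) + p * z\<^sub>1 + a * z) = 0"
      using mean r0(1) unfolding r_def by (simp add: algebra_simps)
    then show ?thesis using \<rho> by simp
  qed
  have quad: "r * (- a / \<rho>)\<^sup>2 + p * z\<^sub>1\<^sup>2 + a * z\<^sup>2 = a * z"
  proof -
    define X where "X = r * (- a / \<rho>)\<^sup>2"
    have X: "\<rho>\<^sup>2 * X = a\<^sup>2 * r"
      unfolding X_def by (rule r0(2))
    have M: "a * (p * (a + \<rho> * z\<^sub>1) + a * (a + \<rho> * z)) = a * a"
      using mean by simp
    \<comment> \<open>Subtracting twice \<open>M\<close> from the second moment identity cancels the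
      cross terms of the squares; \<open>X\<close> hides the division by \<rho>.\<close>
    have "\<rho>\<^sup>2 * (X + p * z\<^sub>1\<^sup>2 + a * z\<^sup>2 - a * z) = 0"
      using props(7) M X unfolding r_def by (simp add: algebra_simps power2_eq_square)
    then show ?thesis unfolding X_def[symmetric] using \<rho> by simp
  qed
  have "Lambda_feasible \<rho> a m q y"
    unfolding Lambda_feasible_def
  proof (intro conjI allI impI)
    fix s i
    show "0 < q s i"
      unfolding q_def using a props(4) k by simp
    have "0 < a + \<rho> * z" "a + \<rho> * z\<^sub>1 < 1"
      using props(1-3) by linarith+
    then show "0 \<le> a + \<rho> * y s i" "a + \<rho> * y s i \<le> 1"
      unfolding y_def using a \<rho> props(1,3) by auto
  next
    fix s show "(\<Sum>i<m. q s i) = S_prob a s"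
      using sums[of "\<lambda>_. 1"] r by (cases s) (auto simp: S_prob_def)
  next
    show "(\<Sum>s\<in>UNIV. \<Sum>i<m. q s i * y s i) = 0"
      using sums[of "\<lambda>x. x"] lin by (simp add: UNIV_bool)
  next
    have "(\<Sum>s\<in>UNIV. \<Sum>i<m. q s i * ((y s i)\<^sup>2 - S_val a s * y s i)) =
        (r * ((- a / \<rho>)\<^sup>2 + a * (- a / \<rho>)) + p * (z\<^sub>1\<^sup>2 + a * z\<^sub>1)) + a * (z\<^sup>2 - (1 - a) * z)"
      using sums(1)[of "\<lambda>x. x\<^sup>2 - (1 - a) * x"] sums(2)[of "\<lambda>x. x\<^sup>2 + a * x"]
      by (simp add: UNIV_bool S_val_def)
    also have "\<dots> = (r * (- a / \<rho>)\<^sup>2 + p * z\<^sub>1\<^sup>2 + a * z\<^sup>2) - a * z + a * (r * (- a / \<rho>) + p * z\<^sub>1 + a * z)"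
      by (simp add: algebra_simps)
    finally show "(\<Sum>s\<in>UNIV. \<Sum>i<m. q s i * ((y s i)\<^sup>2 - S_val a s * y s i)) \<le> 0"
      unfolding lin quad by simp
  qed
  moreover have "(\<Sum>s\<in>UNIV. \<Sum>i<m. q s i * \<Phi> (a + \<rho> * y s i)) = prof_val \<rho> a \<Phi> z"
    using sums[of "\<lambda>x. \<Phi> (a + \<rho> * x)"] \<rho>
    unfolding prof_val_def z\<^sub>1_def[symmetric] p_def[symmetric] r_def by (simp add: UNIV_bool)
  ultimately show ?thesis by blast
qed

theorem theorem2p6:
  fixes \<Phi> :: "real \<Rightarrow> real" and n :: nat and a \<rho> :: real
  assumes "continuous_on {0..1} \<Phi>"
    and "\<forall>x\<in>{0<..<1}. \<Phi> differentiable (at x)"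
    and "mono_on {0<..<1} (deriv \<Phi>)"
    and "continuous_on {0<..<1} (deriv \<Phi>)"
    and "strictly_concave_on {0<..<1} (deriv \<Phi>)"
    and "n \<ge> 1" and "0 < a" and "a < 1" and "0 < \<rho>" and "\<rho> < 1"
    and "2 ^ n * a \<in> \<int>"
  shows "MaxStab n \<rho> \<Phi> a \<le> Gamma_tilde \<rho> a \<Phi> \<and>
         (\<forall>m\<ge>3. Lambda_m \<rho> a m \<Phi> = Gamma_tilde \<rho> a \<Phi>)"
proof (intro conjI allI impI)
  interpret convex_concave_deriv \<Phi>
    using assms by unfold_locales
  note ranges = \<open>0 < a\<close> \<open>a < 1\<close> \<open>0 < \<rho>\<close> \<open>\<rho> < 1\<close>
  show "MaxStab n \<rho> \<Phi> a \<le> Gamma_tilde \<rho> a \<Phi>"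
    using ranges \<open>2 ^ n * a \<in> \<int>\<close> by (rule MaxStab_le_Gamma_tilde)
  fix m :: nat
  assume "3 \<le> m"
  let ?A = "{(p, z). Lambda_feasible \<rho> a m p z}"
  let ?obj = "\<lambda>pz. \<Sum>s\<in>UNIV. \<Sum>i<m. fst pz s i * \<Phi> (a + \<rho> * snd pz s i)"
  have attained: "\<exists>pz\<in>?A. ?obj pz = prof_val \<rho> a \<Phi> z" if z: "z \<in> {0..1 - a}" for z
    using prof_val_attained[OF ranges, of z m \<Phi>] z \<open>3 \<le> m\<close> by force
  have upper: "?obj pz \<le> Gamma_tilde \<rho> a \<Phi>" if "pz \<in> ?A" for pz
    using Lambda_objective_le_Gamma_tilde[OF ranges] that by auto
  \<comment> \<open>\<open>z = 0\<close> gives the constant law \<open>u = a\<close>.\<close>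
  have "?A \<noteq> {}"
    using attained[of 0] ranges by force
  show "Lambda_m \<rho> a m \<Phi> = Gamma_tilde \<rho> a \<Phi>"
  proof (rule antisym)
    show "Lambda_m \<rho> a m \<Phi> \<le> Gamma_tilde \<rho> a \<Phi>"
      unfolding Lambda_m_def using \<open>?A \<noteq> {}\<close> upper by (rule cSUP_least)
    have bdd: "bdd_above (?obj ` ?A)"
      using upper by (rule bdd_aboveI2)
    show "Gamma_tilde \<rho> a \<Phi> \<le> Lambda_m \<rho> a m \<Phi>"
      unfolding Gamma_tilde_eq
    proof (rule cSUP_least)
      fix z assume "z \<in> {0..1 - a}"
      then obtain pz where "pz \<in> ?A" and pz: "?obj pz = prof_val \<rho> a \<Phi> z"
        using attained by blast
      have "?obj pz \<le> Lambda_m \<rho> a m \<Phi>"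
        unfolding Lambda_m_def using \<open>pz \<in> ?A\<close> bdd by (rule cSUP_upper)
      then show "prof_val \<rho> a \<Phi> z \<le> Lambda_m \<rho> a m \<Phi>"
        unfolding pz .
    qed (use ranges in simp)
  qed
qed

end
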